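(* Let $\alpha>0$, $t>0$, and let $\mathrm{p}(n):=\mathrm{p}(n,t)$ be the coefficient of $x^{n-2}$ in the degree-$n$ monic orthogonal polynomial for the weight $w(x,t)=(1-x^2)^\alpha e^{-t/(1-x^2)}$ on $[-1,1]$. For every integer $n\ge 1$, put $$\tilde{\mathrm p}(n-1):=(2n-3+2\alpha)\big(\mathrm p(n-1,t)-\mathrm p(n,t)\big),\qquad \tilde{\mathrm p}(n+1):=(2n+1+2\alpha)\big(\mathrm p(n,t)-\mathrm p(n+1,t)\big).$$ Then $\mathrm p(n)$ satisfies the second-order nonlinear difference equation $$\begin{aligned} &\left(n+2\mathrm p(n)-\tilde{\mathrm p}(n+1)\right)^3+\left(n+2\mathrm p(n)-\tilde{\mathrm p}(n+1)\right)^2\left(n-2+4t-\tilde{\mathrm p}(n-1)+\tilde{\mathrm p}(n+1)\right)\\ &-2\left(n+2\mathrm p(n)-\tilde{\mathrm p}(n+1)\right)\big[n^2-n(1-\alpha)-\alpha+2t-2t^2-\tilde{\mathrm p}(n-1)\left(n+\alpha-t-\tilde{\mathrm p}(n+1)\right)\\ &\qquad-(n-1+2t)\tilde{\mathrm p}(n+1)\big]\\ &-\left(n-1+2t-\tilde{\mathrm p}(n-1)\right)\big[2nt-\tilde{\mathrm p}(n+1)\left(n-1+2t-\tilde{\mathrm p}(n-1)\right)\big]\\ &+4\mathrm p(n)^2\,\tilde{\mathrm p}(n+1)+2\mathrm p(n)\big[\left(n+2\mathrm p(n)-\tilde{\mathrm p}(n+1)\right)^2+2\tilde{\mathrm p}(n+1)\left(n-1+2t-\tilde{\mathrm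 p}(n-1)\right)\\ &\qquad-2\left(n+2\mathrm p(n)-\tilde{\mathrm p}(n+1)\right)\left(n+\alpha-t-\tilde{\mathrm p}(n+1)\right)-2nt\big]=0 . \end{aligned}$$
   Context: Fix $\alpha>0$, $t>0$ and $w(x,t):=(1-x^2)^\alpha e^{-t/(1-x^2)}$, $x\in[-1,1]$. Let $P_n(x,t)$, $n=0,1,2,\ldots$, be the monic polynomials of degree $n$ with $\int_{-1}^1 P_mP_n w\,dx=h_n(t)\delta_{mn}$. Since $w$ is even, $P_n(-x,t)=(-1)^nP_n(x,t)$ and $P_n(x,t)=x^n+\mathrm p(n,t)x^{n-2}+\cdots$; this defines the sub-leading coefficient $\mathrm p(n,t)$, with $\mathrm p(0,t)=\mathrm p(1,t)=0$. *)

theory Defs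
  imports "HOL-Analysis.Analysis" "HOL-Computational_Algebra.Polynomial"
begin

(* Only used for x in [-1,1].  At x = -1 and x = 1 the conventions 0 powr a = 0 and t / 0 = 0
   give the value 0, which is the limit from inside the interval. *)
definition weight :: "real \<Rightarrow> real \<Rightarrow> real \<Rightarrow> real" where
  "weight \<alpha> t x = (1 - x\<^sup>2) powr \<alpha> * exp (- t / (1 - x\<^sup>2))"

definition monic_orthogonal_family ::
    "real \<Rightarrow> real \<Rightarrow> (nat \<Rightarrow> real poly) \<Rightarrow> (nat \<Rightarrow> real) \<Rightarrow> bool" where
  "monic_orthogonal_family \<alpha> t P h \<longleftrightarrow>
     (\<forall>n. degree (P n) = n \<and> lead_coeff (P n) = 1) \<and>
     (\<forall>m n. ((\<lambda>x. poly (P m) x * poly (P n) x * weight \<alpha> t x)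
              has_integral (if m = n then h n else 0)) {-1..1})"

(* The case distinction is needed because n - 2 is truncated subtraction on nat. *)
definition subleading :: "(nat \<Rightarrow> real poly) \<Rightarrow> nat \<Rightarrow> real" where
  "subleading P n = (if n < 2 then 0 else coeff (P n) (n - 2))"

end

theory Submission
  imports Defs
begin

text \<open>
  Write \<open>s = 1 - x\<^sup>2\<close> and let \<open>L\<close> be integration against the weight. Since
  \<open>s\<^sup>2 w' = - 2 x (\<alpha> s + t) w\<close>, integration by parts gives a Pearson identity for \<open>L\<close>, which
  forces a ladder relation expressing \<open>s\<^sup>2 P\<^sub>n'\<close> through \<open>P\<^sub>n\<close> and \<open>P\<^sub>n\<^sub>+\<^sub>1\<close> with coefficients
  explicit in \<open>p\<close>. Together with the three-term recurrence it yields a linear system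
  \<open>s\<^sup>2 v' = M v\<close> for \<open>v = (P\<^sub>n, P\<^sub>n\<^sub>-\<^sub>1)\<close>. Multiplying by the adjugate shows that
  \<open>s\<^sup>2\<close> divides \<open>det M\<cdot>v\<close>, and \<open>v(1) \<noteq> 0\<close>, so \<open>det M\<close> vanishes to second order
  at \<open>x = 1\<close>. The resulting two scalar equations, after elimination of the one quantity
  involving \<open>p(n+2)\<close>, are the difference equation.
\<close>

section \<open>Orthogonal polynomials of an even definite functional\<close>

lemma monom_1_mult_monom:
  "monom 1 1 * f * monom 1 m = f * monom (1 :: 'a :: comm_semiring_1) (Suc m)"
proof -
  have "monom 1 1 * f * monom 1 m = f * (monom 1 1 * monom 1 m)"
    by (simp only: mult_ac)
  then show ?thesis
    by (simp add: mult_monom)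
qed

locale even_functional =
  fixes L :: "real poly \<Rightarrow> real"
  assumes L_add: "L (f + g) = L f + L g"
    and L_smult: "L (smult c f) = c * L f"
    and L_definite: "L (f * f) = 0 \<Longrightarrow> f = 0"
    and L_even: "L (pcompose f [:0, -1:]) = L f"
begin

lemma L_zero [simp]: "L 0 = 0"
  using L_smult[of 0 0] by simp

lemma L_minus: "L (- f) = - L f"
  using L_smult[of "-1" f] by simp

lemma L_diff: "L (f - g) = L f - L g"
  using L_add[of f "- g"] by (simp add: L_minus)

lemma L_sum: "L (sum f A) = (\<Sum>i\<in>A. L (f i))"
  by (induction A rule: infinite_finite_induct) (simp_all add: L_add)

lemma L_mult_monom: "L (f * monom c k) = c * L (f * monom 1 k)"
  using L_smult[of c "f * monom 1 k"] by (simp add: smult_monom flip: mult_smult_right)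

lemma L_mult_eq_0:
  assumes "\<And>m. m < k \<Longrightarrow> L (f * monom 1 m) = 0" and "\<And>i. k \<le> i \<Longrightarrow> coeff g i = 0"
  shows "L (f * g) = 0"
proof -
  have "L (f * monom (coeff g i) i) = 0" for i
    using assms by (cases "i < k") (simp_all add: L_mult_monom[of f "coeff g i"])
  then have "L (f * (\<Sum>i\<le>degree g. monom (coeff g i) i)) = 0"
    by (simp add: sum_distrib_left L_sum)
  then show ?thesis
    by (simp only: poly_as_sum_of_monoms)
qed

text \<open>The criterion behind parity, recurrence and ladder: a polynomial of degree below k that
  is orthogonal to all monomials below x^k is orthogonal to itself, hence zero by
  definiteness.\<close>

lemma eq_0_if_orthogonal:
  assumes "\<And>m. m < k \<Longrightarrow> L (f * monom 1 m) = 0" and "\<And>i. k \<le> i \<Longrightarrow> coeff f i = 0"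
  shows "f = 0"
  using L_mult_eq_0[OF assms] by (rule L_definite)

end

locale even_orthogonal_polys = even_functional +
  fixes P :: "nat \<Rightarrow> real poly"
  assumes degree_P: "degree (P n) = n"
    and lead_P: "lead_coeff (P n) = 1"
    and orth_P: "m \<noteq> n \<Longrightarrow> L (P m * P n) = 0"
begin

section \<open>Norms, moments, parity and the three-term recurrence\<close>

abbreviation sub :: "nat \<Rightarrow> real" where
  "sub \<equiv> subleading P"

definition nrm :: "nat \<Rightarrow> real" where
  "nrm n = L (P n * P n)"

definition \<mu> :: "nat \<Rightarrow> nat \<Rightarrow> real" where
  "\<mu> n k = L (P n * monom 1 k)"

text \<open>The coefficient in x P_n = P_(n+1) + \<beta>_n P_(n-1), obtained by comparing the
  coefficients of x^(n-1).\<close>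

definition \<beta> :: "nat \<Rightarrow> real" where
  "\<beta> n = sub n - sub (Suc n)"

lemma L_P_monom: "L (P n * monom c k) = c * \<mu> n k"
  unfolding \<mu>_def by (rule L_mult_monom)

lemma P_nonzero: "P n \<noteq> 0"
  using lead_P[of n] by auto

lemma nrm_nonzero: "nrm n \<noteq> 0"
  using L_definite P_nonzero unfolding nrm_def by blast

lemma coeff_P_top [simp]: "coeff (P n) n = 1"
  using lead_P[of n] degree_P[of n] by simp

lemma coeff_P_above: "n < i \<Longrightarrow> coeff (P n) i = 0"
  by (simp add: coeff_eq_0 degree_P)

lemma P_0: "P 0 = 1"
  using degree_0_id[of "P 0"] degree_P[of 0] coeff_P_top[of 0] by (simp add: one_pCons)

text \<open>\<open>monom 1 k - P k\<close> has no coefficients from x^k on, so the induction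
  hypothesis kills it and only \<open>L (P n * P k) = 0\<close> remains.\<close>

lemma \<mu>_below: "k < n \<Longrightarrow> \<mu> n k = 0"
proof (induction k rule: less_induct)
  case (less k)
  have "L (P n * (monom 1 k - P k)) = 0"
  proof (rule L_mult_eq_0)
    show "L (P n * monom 1 m) = 0" if "m < k" for m
      using less that by (simp add: \<mu>_def)
    show "coeff (monom 1 k - P k) i = 0" if "k \<le> i" for i
      using that by (cases "i = k") (auto simp: coeff_P_above)
  qed
  then show ?case
    using orth_P[of n k] less.prems by (simp add: \<mu>_def L_diff right_diff_distrib)
qed

text \<open>By evenness of \<open>L\<close>, (-1)^n P_n(-x) is monic with the same orthogonality as
  P_n, so the two coincide.\<close>

lemma coeff_P_odd:
  assumes "odd (n + i)"
  shows "coeff (P n) i = 0"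
proof -
  define R where "R = smult ((-1) ^ n) (pcompose (P n) [:0, -1:]) - P n"
  have coeff_R: "coeff R i = ((-1) ^ n * (-1) ^ i - 1) * coeff (P n) i" for i
    by (simp add: R_def coeff_pcompose_linear algebra_simps)
  have "R = 0"
  proof (rule eq_0_if_orthogonal[where k = n])
    show "coeff R i = 0" if "n \<le> i" for i
      using that by (cases "i = n") (auto simp: coeff_R coeff_P_above simp flip: power_add)
    fix m assume "m < n"
    have "pcompose (monom 1 m) [:0, -1:] = smult ((-1) ^ m) (monom (1::real) m)"
      by (rule poly_eqI) (simp add: coeff_pcompose_linear)
    then have "pcompose (P n * monom 1 m) [:0, -1:] =
        smult ((-1) ^ m) (pcompose (P n) [:0, -1:] * monom 1 m)"
      by (simp add: pcompose_mult)
    then have "(-1) ^ m * L (pcompose (P n) [:0, -1:] * monom 1 m) = L (P n * monom 1 m)"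
      using L_even[of "P n * monom 1 m"] by (simp only: L_smult)
    then have "L (pcompose (P n) [:0, -1:] * monom 1 m) = 0"
      using \<mu>_below[OF \<open>m < n\<close>] by (simp add: \<mu>_def)
    then show "L (R * monom 1 m) = 0"
      using \<mu>_below[OF \<open>m < n\<close>] by (simp add: R_def \<mu>_def left_diff_distrib L_diff L_smult)
  qed
  then have "((-1) ^ (n + i) - 1) * coeff (P n) i = 0"
    using coeff_R[of i] by (simp add: power_add)
  then show ?thesis
    using assms by simp
qed

lemma \<mu>_diag: "\<mu> n n = nrm n"
proof -
  have "L (P n * (P n - monom 1 n)) = 0"
    by (rule L_mult_eq_0[where k = n])
       (use \<mu>_below[of _ n] coeff_P_above[of n] in \<open>auto simp: \<mu>_def le_less\<close>)
  then show ?thesis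
    by (simp add: \<mu>_def nrm_def right_diff_distrib L_diff)
qed

lemma \<mu>_Suc: "\<mu> n (Suc n) = 0"
proof -
  have "L (P n * (P (Suc n) - monom 1 (Suc n))) = 0"
  proof (rule L_mult_eq_0[where k = n])
    show "coeff (P (Suc n) - monom 1 (Suc n)) i = 0" if "n \<le> i" for i
      using that coeff_P_above[of "Suc n" i] coeff_P_odd[of "Suc n" n]
      by (cases "i = n \<or> i = Suc n") auto
  qed (use \<mu>_below[of _ n] in \<open>auto simp: \<mu>_def\<close>)
  then show ?thesis
    using orth_P[of n "Suc n"] by (simp add: \<mu>_def right_diff_distrib L_diff)
qed

text \<open>Up to terms of degree below n, which \<open>P n\<close> annihilates, x^(n+2) is
  \<open>P (n + 2)\<close> minus \<open>sub (n + 2)\<close> x^n; parity excludes an x^(n+1)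
  term.\<close>

lemma \<mu>_Suc_Suc: "\<mu> n (n + 2) = - sub (n + 2) * nrm n"
proof -
  let ?g = "P (n + 2) - monom 1 (n + 2) - monom (sub (n + 2)) n"
  have "L (P n * ?g) = 0"
  proof (rule L_mult_eq_0[where k = n])
    show "coeff ?g i = 0" if "n \<le> i" for i
    proof -
      consider "i = n" | "i = n + 1" | "i = n + 2" | "n + 2 < i"
        using \<open>n \<le> i\<close> by linarith
      then show ?thesis
        using coeff_P_above[of "n + 2" i] coeff_P_odd[of "n + 2" "n + 1"] coeff_P_top[of "n + 2"]
        by cases (auto simp: subleading_def)
    qed
  qed (use \<mu>_below[of _ n] in \<open>auto simp: \<mu>_def\<close>)
  then show ?thesis
    using orth_P[of n "n + 2"]
    by (simp add: right_diff_distrib L_diff L_P_monom \<mu>_diag)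
qed

text \<open>A factor x can be moved to the test monomial, so the difference of the sides is
  orthogonal below x^n; parity and the choice of \<beta> cancel its coefficients from x^n
  on.\<close>

lemma recurrence: "monom 1 1 * P (Suc n) = P (Suc (Suc n)) + smult (\<beta> (Suc n)) (P n)"
proof -
  define R where "R = monom 1 1 * P (Suc n) - P (Suc (Suc n)) - smult (\<beta> (Suc n)) (P n)"
  have "R = 0"
  proof (rule eq_0_if_orthogonal[where k = n])
    show "L (R * monom 1 m) = 0" if "m < n" for m
    proof -
      have "R * monom 1 m = P (Suc n) * monom 1 (Suc m) - P (Suc (Suc n)) * monom 1 m
          - smult (\<beta> (Suc n)) (P n * monom 1 m)"
        by (simp only: R_def left_diff_distrib monom_1_mult_monom mult_smult_left)
      then show ?thesis
        using that by (simp add: L_diff L_smult L_P_monom \<mu>_below)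
    qed
    fix i assume "n \<le> i"
    then consider "i = n" | "i = n + 1" | "i = n + 2" | "n + 2 < i"
      by linarith
    then show "coeff R i = 0"
    proof cases
      case 1
      \<comment> \<open>For n = 0 the shifted coefficient is 0, in agreement with the default
        \<open>sub 1 = 0\<close>.\<close>
      then show ?thesis
        by (cases n) (auto simp: R_def coeff_monom_mult \<beta>_def subleading_def)
    next
      case 2
      then show ?thesis
        using coeff_P_odd[of "Suc n" n] coeff_P_odd[of "Suc (Suc n)" "Suc n"]
        by (auto simp: R_def coeff_monom_mult coeff_P_above)
    next
      case 3
      then show ?thesis
        by (auto simp: R_def coeff_monom_mult coeff_P_above)
    next
      case 4
      then show ?thesis
        by (auto simp: R_def coeff_monom_mult coeff_P_above)
    qed
  qed
  then show ?thesis
    by (simp add: R_def algebra_simps)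
qed

lemma nrm_Suc: "nrm (Suc n) = \<beta> (Suc n) * nrm n"
proof -
  have "P (Suc n) * monom 1 (Suc n) = (monom 1 1 * P (Suc n)) * monom 1 n"
    by (simp only: monom_1_mult_monom)
  also have "\<dots> = P (Suc (Suc n)) * monom 1 n + smult (\<beta> (Suc n)) (P n * monom 1 n)"
    by (simp only: recurrence distrib_right mult_smult_left)
  finally have "\<mu> (Suc n) (Suc n) = \<mu> (Suc (Suc n)) n + \<beta> (Suc n) * \<mu> n n"
    by (simp add: \<mu>_def L_add L_smult)
  then show ?thesis
    by (simp add: \<mu>_diag \<mu>_below)
qed

text \<open>As \<beta> is nonzero, the recurrence would carry a common root of two neighbours down
  to \<open>P 0 = 1\<close>.\<close>

lemma no_common_root: "poly (P (Suc n)) x = 0 \<Longrightarrow> poly (P n) x \<noteq> 0"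
proof (induction n)
  case 0
  then show ?case
    by (simp add: P_0)
next
  case (Suc n)
  have "\<beta> (Suc n) \<noteq> 0"
    using nrm_Suc nrm_nonzero by (metis mult_zero_left)
  then show ?case
    using Suc arg_cong[OF recurrence[of n], of "\<lambda>q. poly q x"] by auto
qed

end

section \<open>The ladder relation and its compatibility conditions\<close>

text \<open>With s = 1 - x^2, \<open>Pearson\<close> says that the integral of (s^2 q w)' is zero:
  the cubic on the right is -(s^2)' - s^2 w'/w.\<close>

locale semiclassical_polys = even_orthogonal_polys +
  fixes \<alpha> t :: real
  assumes Pearson: "L ((1 - monom 2 2 + monom 1 4) * pderiv q) =
      L ((monom (2 * (\<alpha> + 2 + t)) 1 - monom (2 * (\<alpha> + 2)) 3) * q)"
begin

text \<open>
  In the usual notation of ladder operators, \<open>P\<^sub>n' = \<beta>\<^sub>n A\<^sub>n P\<^sub>n\<^sub>-\<^sub>1 - B\<^sub>n P\<^sub>n\<close> with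
  \<open>A\<^sub>n = a1 n / s + a0 n / s\<^sup>2\<close>, \<open>B\<^sub>n = x (n / s + D n / s\<^sup>2)\<close> and \<open>s = 1 - x\<^sup>2\<close>. The
  polynomial \<open>1 - monom 2 2 + monom 1 4\<close> is \<open>s\<^sup>2\<close>.
\<close>

definition D :: "nat \<Rightarrow> real" where
  "D n = real n + 2 * sub n - (2 * real n + 1 + 2 * \<alpha>) * \<beta> n"

definition a0 :: "nat \<Rightarrow> real" where
  "a0 n = D n + D (Suc n) + 2 * t"

definition a1 :: "nat \<Rightarrow> real" where
  "a1 n = 2 * real n + 1 + 2 * \<alpha>"

text \<open>Using \<open>P (Suc n)\<close> instead of P_(n-1) includes n = 0. The difference
  \<open>T\<close> of the sides is orthogonal below x^n by \<open>Pearson\<close>. Four conditions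
  are not automatic: m = n - 1 gives the formula for \<open>D (Suc n)\<close>, m = n - 3 the
  constant n + 1 + 2\<alpha>, the coefficient of x^(n+3) gives \<open>a1 n\<close> and that of
  x^(n+1) gives \<open>a0 n\<close>.\<close>

lemma ladder:
  "(1 - monom 2 2 + monom 1 4) * pderiv (P n) =
     (monom (D (Suc n) + 2 * t + (real n + 1 + 2 * \<alpha>)) 1 - monom (real n + 1 + 2 * \<alpha>) 3) * P n
     - (monom (a0 n + a1 n) 0 - monom (a1 n) 2) * P (Suc n)"
proof -
  define T where "T = (1 - monom 2 2 + monom 1 4) * pderiv (P n)
     - (monom (D (Suc n) + 2 * t + (real n + 1 + 2 * \<alpha>)) 1 - monom (real n + 1 + 2 * \<alpha>) 3) * P n
     + (monom (a0 n + a1 n) 0 - monom (a1 n) 2) * P (Suc n)"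
  have \<beta>n: "\<beta> (Suc n) = sub (Suc n) - sub (n + 2)"
    by (simp add: \<beta>_def)
  have "T = 0"
  proof (rule eq_0_if_orthogonal[where k = n])
    fix m assume "m < n"
    have "L ((1 - monom 2 2 + monom 1 4) * pderiv (P n * monom 1 m)) =
        L ((1 - monom 2 2 + monom 1 4) * pderiv (P n) * monom 1 m) +
        L (P n * monom (real m) (m - 1) - P n * monom (2 * real m) (m - 1 + 2)
           + P n * monom (real m) (m - 1 + 4))"
      by (simp add: pderiv_mult pderiv_monom algebra_simps mult_monom flip: L_add L_diff)
    \<comment> \<open>The moment of x^(m-1) vanishes since m < n; at m = 0 the truncated exponent is
      harmless because of the factor \<open>real m\<close>.\<close>
    also have "L (P n * monom (real m) (m - 1) - P n * monom (2 * real m) (m - 1 + 2)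
           + P n * monom (real m) (m - 1 + 4)) =
        - 2 * real m * \<mu> n (m + 1) + real m * \<mu> n (m + 3)"
      using \<open>m < n\<close>
      by (cases m) (simp_all add: L_add L_diff L_P_monom \<mu>_below eval_nat_numeral algebra_simps)
    also have "L ((1 - monom 2 2 + monom 1 4) * pderiv (P n * monom 1 m)) =
        L (P n * monom (2 * (\<alpha> + 2 + t)) (m + 1) - P n * monom (2 * (\<alpha> + 2)) (m + 3))"
      unfolding Pearson by (simp add: algebra_simps mult_monom)
    also have "\<dots> = 2 * (\<alpha> + 2 + t) * \<mu> n (m + 1) - 2 * (\<alpha> + 2) * \<mu> n (m + 3)"
      by (simp add: L_diff L_P_monom)
    finally have *: "L ((1 - monom 2 2 + monom 1 4) * pderiv (P n) * monom 1 m) =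
        2 * (\<alpha> + 2 + t) * \<mu> n (m + 1) - 2 * (\<alpha> + 2) * \<mu> n (m + 3)
        + 2 * real m * \<mu> n (m + 1) - real m * \<mu> n (m + 3)"
      by simp
    have "T * monom 1 m = (1 - monom 2 2 + monom 1 4) * pderiv (P n) * monom 1 m
      - (P n * monom (D (Suc n) + 2 * t + (real n + 1 + 2 * \<alpha>)) (m + 1)
         - P n * monom (real n + 1 + 2 * \<alpha>) (m + 3))
      + (P (Suc n) * monom (a0 n + a1 n) m - P (Suc n) * monom (a1 n) (m + 2))"
      by (simp add: T_def algebra_simps mult_monom)
    then have LT: "L (T * monom 1 m) =
        2 * (\<alpha> + 2 + t) * \<mu> n (m + 1) - 2 * (\<alpha> + 2) * \<mu> n (m + 3)
        + 2 * real m * \<mu> n (m + 1) - real m * \<mu> n (m + 3)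
        - (D (Suc n) + 2 * t + (real n + 1 + 2 * \<alpha>)) * \<mu> n (m + 1)
        + (real n + 1 + 2 * \<alpha>) * \<mu> n (m + 3) - a1 n * \<mu> (Suc n) (m + 2)"
      using \<open>m < n\<close> * by (simp add: L_add L_diff L_P_monom \<mu>_below)
    \<comment> \<open>Moments reach at most x^(n+2); m = n - 2 drops out by parity and
      orthogonality, m < n - 3 by orthogonality alone.\<close>
    consider "m + 1 = n" | "m + 2 = n" | "m + 3 = n" | "m + 3 < n"
      using \<open>m < n\<close> by linarith
    then show "L (T * monom 1 m) = 0"
    proof cases
      case 1
      then have \<mu>_vals: "\<mu> n (m + 1) = nrm n" "\<mu> n (m + 3) = - sub (n + 2) * nrm n"
        "\<mu> (Suc n) (m + 2) = \<beta> (Suc n) * nrm n" "real m = real n - 1"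
        using \<mu>_diag[of n] \<mu>_Suc_Suc[of n] \<mu>_diag[of "Suc n"]
        by (auto simp: nrm_Suc eval_nat_numeral)
      then show ?thesis
        unfolding LT \<mu>_vals a1_def D_def[of "Suc n"] \<beta>n by (simp add: algebra_simps)
    next
      case 2
      then have "\<mu> n (m + 1) = 0" "\<mu> n (m + 3) = 0" "\<mu> (Suc n) (m + 2) = 0"
        using \<mu>_Suc[of n] by (auto simp: \<mu>_below eval_nat_numeral)
      then show ?thesis
        unfolding LT by simp
    next
      case 3
      then have \<mu>_vals: "\<mu> n (m + 1) = 0" "\<mu> (Suc n) (m + 2) = 0" "real m = real n - 3"
        by (auto simp: \<mu>_below)
      show ?thesis
        unfolding LT \<mu>_vals by (simp add: algebra_simps)
    next
      case 4
      then have "\<mu> n (m + 1) = 0" "\<mu> n (m + 3) = 0" "\<mu> (Suc n) (m + 2) = 0"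
        by (auto simp: \<mu>_below)
      then show ?thesis
        unfolding LT by simp
    qed
  next
    fix i assume "n \<le> i"
    have coeff_T: "coeff T i = coeff (pderiv (P n)) i
      - (if i < 2 then 0 else 2 * coeff (pderiv (P n)) (i - 2))
      + (if i < 4 then 0 else coeff (pderiv (P n)) (i - 4))
      - (if i < 1 then 0 else (D (Suc n) + 2 * t + (real n + 1 + 2 * \<alpha>)) * coeff (P n) (i - 1))
      + (if i < 3 then 0 else (real n + 1 + 2 * \<alpha>) * coeff (P n) (i - 3))
      + (a0 n + a1 n) * coeff (P (Suc n)) i
      - (if i < 2 then 0 else a1 n * coeff (P (Suc n)) (i - 2))" for i
      by (simp add: T_def left_diff_distrib distrib_right coeff_monom_mult)
    have odd: "coeff T i = 0" if "even (n + i)" for i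
      using that by (auto simp: coeff_T coeff_pderiv coeff_P_odd)
    consider "i = n \<or> i = n + 2" | "i = n + 1" | "i = n + 3" | "n + 3 < i"
      using \<open>n \<le> i\<close> by linarith
    then show "coeff T i = 0"
    proof cases
      case 1
      then show ?thesis
        by (intro odd) auto
    next
      case 2
      \<comment> \<open>The value (n - 2) \<open>sub n\<close> is zero for n \<le> 2, so it also
        covers the default branch.\<close>
      consider "n = 0" | "n = 1" | "n = 2" | k where "n = k + 3"
        by (metis One_nat_def Suc_1 add.commute less_Suc_eq less_imp_add_positive
            less_Suc0 linorder_not_less le_Suc_ex numeral_3_eq_3)
      then have "(if i < 4 then 0 else coeff (pderiv (P n)) (i - 4)) = (real n - 2) * sub n"
        using 2 by cases (auto simp: coeff_pderiv subleading_def eval_nat_numeral)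
      moreover have "(if i < 3 then 0 else (real n + 1 + 2 * \<alpha>) * coeff (P n) (i - 3)) =
          (real n + 1 + 2 * \<alpha>) * sub n"
        using 2 by (auto simp: subleading_def eval_nat_numeral)
      moreover have "(if i < 2 then 0 else 2 * coeff (pderiv (P n)) (i - 2)) = 2 * real n"
        using 2 by (cases n) (auto simp: coeff_pderiv)
      moreover have "(if i < 2 then 0 else a1 n * coeff (P (Suc n)) (i - 2)) = a1 n * sub (Suc n)"
        using 2 by (auto simp: subleading_def)
      ultimately have "coeff T i = coeff (pderiv (P n)) i - 2 * real n + (real n - 2) * sub n
          - (D (Suc n) + 2 * t + (real n + 1 + 2 * \<alpha>)) * coeff (P n) n
          + (real n + 1 + 2 * \<alpha>) * sub n + (a0 n + a1 n) * coeff (P (Suc n)) (Suc n)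
          - a1 n * sub (Suc n)"
        using 2 unfolding coeff_T by simp
      also have "\<dots> = 0"
        using 2 by (simp add: coeff_pderiv coeff_P_above a0_def a1_def D_def[of n] \<beta>_def[of n]
            algebra_simps)
      finally show ?thesis .
    next
      case 3
      then show ?thesis
        by (simp add: coeff_T coeff_pderiv coeff_P_above a1_def)
    next
      case 4
      then show ?thesis
        by (simp add: coeff_T coeff_pderiv coeff_P_above)
    qed
  qed
  then show ?thesis
    by (simp add: T_def algebra_simps)
qed

text \<open>The recurrence eliminates \<open>P (Suc (Suc n))\<close> from \<open>ladder\<close> at
  index \<open>Suc n\<close>.\<close>

lemma ladder_lower:
  "(1 - monom 2 2 + monom 1 4) * pderiv (P (Suc n)) =
     smult (\<beta> (Suc n)) (monom (a0 (Suc n) + a1 (Suc n)) 0 - monom (a1 (Suc n)) 2) * P n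
     - (monom (D (Suc n) + real (Suc n)) 1 - monom (real (Suc n)) 3) * P (Suc n)"
proof -
  have "poly ((1 - monom 2 2 + monom 1 4) * pderiv (P (Suc n))) x =
     poly (smult (\<beta> (Suc n)) (monom (a0 (Suc n) + a1 (Suc n)) 0 - monom (a1 (Suc n)) 2) * P n
     - (monom (D (Suc n) + real (Suc n)) 1 - monom (real (Suc n)) 3) * P (Suc n)) x" for x
    using arg_cong[OF recurrence[of n], of "\<lambda>q. poly q x"]
      arg_cong[OF ladder[of "Suc n"], of "\<lambda>q. poly q x"]
    by (simp add: poly_monom a0_def a1_def) algebra
  then show ?thesis
    by (simp flip: poly_eq_poly_eq_iff add: fun_eq_iff)
qed

lemma
  shows compatibility_double_pole: "\<beta> (Suc n) * a0 (Suc n) * a0 n = D (Suc n) * (D (Suc n) + 2 * t)"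
    and compatibility_simple_pole: "\<beta> (Suc n) * (a0 (Suc n) * a1 n + a1 (Suc n) * a0 n) =
      - (D (Suc n))\<^sup>2 + 2 * (real (Suc n) + \<alpha> - t) * D (Suc n) + 2 * t * real (Suc n)"
proof -
  define N where "N = Suc n"
  define S where "S = 1 - monom 2 2 + monom (1 :: real) 4"
  define X where "X = monom (D N + real N) 1 - monom (real N) 3"
  define Y where "Y = smult (\<beta> N) (monom (a0 N + a1 N) 0 - monom (a1 N) 2)"
  define Z where "Z = monom (D N + 2 * t + (real N + 2 * \<alpha>)) 1 - monom (real N + 2 * \<alpha>) 3"
  define W where "W = monom (a0 n + a1 n) 0 - monom (a1 n) 2"
  \<comment> \<open>The determinant of the system for (P_N, P_n) with matrix rows (-X, Y) and (-W,
    Z); the identities \<open>\<delta>_P\<close> come from its adjugate.\<close>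
  define \<delta> where "\<delta> = Y * W - X * Z"
  have eqs: "S * pderiv (P N) = Y * P n - X * P N" "S * pderiv (P n) = Z * P n - W * P N"
    using ladder_lower[of n] ladder[of n]
    by (simp_all add: N_def S_def X_def Y_def Z_def W_def add_ac)
  have \<delta>_P: "\<delta> * P N = S * (Z * pderiv (P N) - Y * pderiv (P n))"
    "\<delta> * P n = S * (W * pderiv (P N) - X * pderiv (P n))"
    using eqs unfolding \<delta>_def by algebra+
  have S1: "poly S 1 = 0" "poly (pderiv S) 1 = 0"
    by (simp_all add: S_def poly_monom pderiv_diff pderiv_add pderiv_monom)
  \<comment> \<open>\<open>S\<close> has a double zero at 1, so both \<delta> f and its derivative
    vanish there. The value and the derivative of \<delta> at 1 yield the two claims.\<close>
  have vanish: "poly \<delta> 1 = 0 \<and> poly (pderiv \<delta>) 1 = 0" if "\<delta> * f = S * g" "poly f 1 \<noteq> 0" for f g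
  proof -
    have "poly \<delta> 1 * poly f 1 = 0"
      using arg_cong[OF that(1), of "\<lambda>q. poly q 1"] S1 by simp
    moreover have "poly \<delta> 1 * poly (pderiv f) 1 + poly f 1 * poly (pderiv \<delta>) 1 = 0"
      using arg_cong[OF that(1), of "\<lambda>q. poly (pderiv q) 1"] S1 by (simp add: pderiv_mult)
    ultimately show ?thesis
      using that(2) by simp
  qed
  have "poly (P N) 1 \<noteq> 0 \<or> poly (P n) 1 \<noteq> 0"
    using no_common_root[of n 1] by (auto simp: N_def)
  then have \<delta>1: "poly \<delta> 1 = 0" "poly (pderiv \<delta>) 1 = 0"
    using vanish \<delta>_P by blast+
  note at_1 = X_def Y_def Z_def W_def poly_monom pderiv_monom pderiv_diff pderiv_smult pderiv_mult
  show "\<beta> (Suc n) * a0 (Suc n) * a0 n = D (Suc n) * (D (Suc n) + 2 * t)"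
    using \<delta>1(1) by (simp add: \<delta>_def at_1 flip: N_def)
  show "\<beta> (Suc n) * (a0 (Suc n) * a1 n + a1 (Suc n) * a0 n) =
      - (D (Suc n))\<^sup>2 + 2 * (real (Suc n) + \<alpha> - t) * D (Suc n) + 2 * t * real (Suc n)"
    using \<delta>1(2) unfolding N_def[symmetric] by (simp add: \<delta>_def at_1) algebra
qed

text \<open>Here \<open>A\<close> is \<open>D (Suc n)\<close>, while \<open>pm\<close> and
  \<open>pp\<close> are the two quantities written p-tilde, for the index
  \<open>Suc n\<close>.\<close>

lemma difference_equation:
  assumes "pm = (2 * real n - 1 + 2 * \<alpha>) * \<beta> n" and "pp = (2 * real n + 3 + 2 * \<alpha>) * \<beta> (Suc n)"
    and A: "A = real (Suc n) + 2 * sub (Suc n) - pp"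
    and B: "B = real (Suc n) - 1 + 2 * t - pm"
    and C: "C = real (Suc n) + \<alpha> - t - pp"
  shows "A ^ 3 + A\<^sup>2 * (real (Suc n) - 2 + 4 * t - pm + pp)
       - 2 * A * ((real (Suc n))\<^sup>2 - real (Suc n) * (1 - \<alpha>) - \<alpha> + 2 * t - 2 * t\<^sup>2
             - pm * C - (real (Suc n) - 1 + 2 * t) * pp)
       - B * (2 * real (Suc n) * t - pp * B)
       + 4 * (sub (Suc n))\<^sup>2 * pp
       + 2 * sub (Suc n) * (A\<^sup>2 + 2 * pp * B - 2 * A * C - 2 * real (Suc n) * t) = 0"
proof -
  have D1: "D (Suc n) = A"
    using assms by (simp add: D_def algebra_simps)
  \<comment> \<open>The definition of \<open>\<beta> n\<close> trades \<open>sub n\<close> for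
    \<open>sub (Suc n)\<close>.\<close>
  have a0: "a0 n = A + 2 * sub (Suc n) + B"
    unfolding a0_def D1 using assms(1) by (simp add: D_def[of n] \<beta>_def B algebra_simps)
  have pp: "pp = a1 (Suc n) * \<beta> (Suc n)"
    using assms(2) by (simp add: a1_def algebra_simps)
  \<comment> \<open>The simple-pole identity times \<open>a0 n\<close>; the double-pole identity
    then removes \<open>a0 (Suc n)\<close>, the only quantity that reaches
    \<open>sub (n + 3)\<close>.\<close>
  have "a1 n * (A * (A + 2 * t)) + pp * (a0 n)\<^sup>2
      - (- A\<^sup>2 + 2 * (real (Suc n) + \<alpha> - t) * A + 2 * t * real (Suc n)) * a0 n = 0"
    using compatibility_double_pole[of n] compatibility_simple_pole[of n]
    unfolding D1 pp by algebra
  then show ?thesis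
    unfolding a0 a1_def using A B C by simp algebra
qed

end

section \<open>Integration against the weight\<close>

lemma weight_nonneg: "0 \<le> weight \<alpha> t x"
  by (simp add: weight_def)

text \<open>At the endpoints the weight is squeezed between 0 and (1 - x^2)^\<alpha>, which tends to
  0 as \<alpha> > 0.\<close>

lemma weight_continuous:
  assumes "\<alpha> > 0" "t > 0"
  shows "continuous_on {-1..1} (weight \<alpha> t)"
  unfolding continuous_on_eq_continuous_within
proof
  fix x :: real
  assume x: "x \<in> {-1..1}"
  show "continuous (at x within {-1..1}) (weight \<alpha> t)"
  proof (cases "x\<^sup>2 = 1")
    case False
    then have "1 - x\<^sup>2 \<noteq> 0"
      by simp
    then have "isCont (weight \<alpha> t) x"
      unfolding weight_def by (intro continuous_intros) auto
    then show ?thesis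
      by (rule continuous_at_imp_continuous_at_within)
  next
    case True
    have "((\<lambda>y. (1 - y\<^sup>2) powr \<alpha>) \<longlongrightarrow> (1 - x\<^sup>2) powr \<alpha>) (at x within {-1..1})"
      using \<open>\<alpha> > 0\<close>
      by (intro tendsto_powr' tendsto_intros)
         (auto simp: eventually_at_filter abs_square_le_1 abs_le_iff intro!: always_eventually)
    then have lim: "((\<lambda>y. (1 - y\<^sup>2) powr \<alpha>) \<longlongrightarrow> 0) (at x within {-1..1})"
      using True by simp
    have "weight \<alpha> t y \<le> (1 - y\<^sup>2) powr \<alpha>" if "y \<in> {-1..1}" for y
    proof -
      have "0 \<le> 1 - y\<^sup>2"
        using that by (simp add: abs_square_le_1 abs_le_iff)
      then have "exp (- t / (1 - y\<^sup>2)) \<le> 1"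
        using \<open>t > 0\<close> by simp
      then show ?thesis
        unfolding weight_def by (simp add: mult_left_le)
    qed
    then have "(weight \<alpha> t \<longlongrightarrow> 0) (at x within {-1..1})"
      by (intro tendsto_sandwich[OF _ _ tendsto_const lim])
         (auto simp: eventually_at_filter weight_nonneg intro!: always_eventually)
    then show ?thesis
      using True by (simp add: continuous_within weight_def)
  qed
qed

text \<open>The exponential gives the logarithmic derivative a double pole in 1 - x^2, hence the
  factor s^2 in \<open>Pearson\<close>.\<close>

lemma weight_deriv:
  assumes "x \<in> {-1<..<1}"
  shows "(weight \<alpha> t has_real_derivative
          - (2 * x * (\<alpha> * (1 - x\<^sup>2) + t)) / (1 - x\<^sup>2)\<^sup>2 * weight \<alpha> t x) (at x)"
proof -
  have pos: "1 - x\<^sup>2 > 0"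
    using assms by (simp add: abs_square_less_1 abs_less_iff)
  have "((\<lambda>x. (1 - x\<^sup>2) powr \<alpha>) has_real_derivative
          (1 - x\<^sup>2) powr \<alpha> * (- 2 * x * \<alpha> / (1 - x\<^sup>2))) (at x)"
    using pos by (auto intro!: derivative_eq_intros simp: powr_diff)
  moreover have "((\<lambda>x. exp (- t / (1 - x\<^sup>2))) has_real_derivative
          exp (- t / (1 - x\<^sup>2)) * (- 2 * x * t / (1 - x\<^sup>2)\<^sup>2)) (at x)"
    using pos by (auto intro!: derivative_eq_intros simp: power2_eq_square)
  ultimately have "(weight \<alpha> t has_real_derivative
      (1 - x\<^sup>2) powr \<alpha> * (- 2 * x * \<alpha> / (1 - x\<^sup>2)) * exp (- t / (1 - x\<^sup>2)) +
      exp (- t / (1 - x\<^sup>2)) * (- 2 * x * t / (1 - x\<^sup>2)\<^sup>2) * (1 - x\<^sup>2) powr \<alpha>) (at x)"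
    unfolding weight_def by (rule DERIV_mult)
  also have "(1 - x\<^sup>2) powr \<alpha> * (- 2 * x * \<alpha> / (1 - x\<^sup>2)) * exp (- t / (1 - x\<^sup>2)) +
      exp (- t / (1 - x\<^sup>2)) * (- 2 * x * t / (1 - x\<^sup>2)\<^sup>2) * (1 - x\<^sup>2) powr \<alpha> =
      (- 2 * x * \<alpha> / (1 - x\<^sup>2) - 2 * x * t / (1 - x\<^sup>2)\<^sup>2) * weight \<alpha> t x"
    by (simp add: weight_def algebra_simps)
  also have "- 2 * x * \<alpha> / (1 - x\<^sup>2) - 2 * x * t / (1 - x\<^sup>2)\<^sup>2 =
      - (2 * x * (\<alpha> * (1 - x\<^sup>2) + t)) / (1 - x\<^sup>2)\<^sup>2"
    using pos by (simp add: divide_simps power2_eq_square) algebra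
  finally show ?thesis .
qed

section \<open>Integration against the weight as an even definite functional\<close>

definition weighted_integral :: "real \<Rightarrow> real \<Rightarrow> real poly \<Rightarrow> real" where
  "weighted_integral \<alpha> t q = integral {-1..1} (\<lambda>x. poly q x * weight \<alpha> t x)"

lemma weighted_integrable:
  assumes "\<alpha> > 0" "t > 0"
  shows "(\<lambda>x. poly q x * weight \<alpha> t x) integrable_on {-1..1}"
  using weight_continuous[OF assms] by (intro integrable_continuous_real continuous_intros)

lemma weighted_integral_add:
  assumes "\<alpha> > 0" "t > 0"
  shows "weighted_integral \<alpha> t (f + g) = weighted_integral \<alpha> t f + weighted_integral \<alpha> t g"
  using integral_add[OF weighted_integrable[OF assms, of f] weighted_integrable[OF assms, of g]]
  by (simp add: weighted_integral_def distrib_right)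

lemma weighted_integral_smult:
  "weighted_integral \<alpha> t (smult c f) = c * weighted_integral \<alpha> t f"
  by (simp add: weighted_integral_def mult.assoc)

text \<open>A continuous nonnegative integrand with zero integral vanishes; the weight is positive
  inside, so q would have infinitely many roots.\<close>

lemma weighted_integral_definite:
  assumes "\<alpha> > 0" "t > 0" and zero: "weighted_integral \<alpha> t (q * q) = 0"
  shows "q = 0"
proof (rule ccontr)
  assume "q \<noteq> 0"
  have "poly q x = 0" if x: "x \<in> {-1<..<1}" for x
  proof -
    have "poly (q * q) x * weight \<alpha> t x = 0"
    proof (rule has_integral_0_cbox_imp_0[of "-1" 1 "\<lambda>x. poly (q * q) x * weight \<alpha> t x"])
      show "continuous_on (cbox (- 1) 1) (\<lambda>x. poly (q * q) x * weight \<alpha> t x)"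
        using weight_continuous[OF assms(1,2)] by (auto intro!: continuous_intros)
      show "((\<lambda>x. poly (q * q) x * weight \<alpha> t x) has_integral 0) (cbox (- 1) 1)"
        using zero weighted_integrable[OF assms(1,2), of "q * q"]
        by (simp add: weighted_integral_def has_integral_iff)
    qed (use x in \<open>auto simp: weight_nonneg\<close>)
    moreover have "1 - x\<^sup>2 > 0"
      using x by (simp add: abs_square_less_1 abs_less_iff)
    then have "weight \<alpha> t x \<noteq> 0"
      by (simp add: weight_def)
    ultimately show ?thesis
      by simp
  qed
  then have "{-1<..<1} \<subseteq> {x. poly q x = 0}"
    by auto
  then have "finite {-1<..<1::real}"
    using poly_roots_finite[OF \<open>q \<noteq> 0\<close>] finite_subset by blast
  then show False
    by (simp add: infinite_Ioo)
qed

lemma weighted_integral_even: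
  "weighted_integral \<alpha> t (pcompose q [:0, -1:]) = weighted_integral \<alpha> t q"
  using Henstock_Kurzweil_Integration.integral_reflect_real
    [where a = "-1" and b = 1 and f = "\<lambda>x. poly q x * weight \<alpha> t x"]
  by (simp add: weighted_integral_def poly_pcompose weight_def)

text \<open>The fundamental theorem of calculus for (1 - x^2)^2 q w, which is zero at both
  endpoints; the derivative is needed only in the interior.\<close>

lemma weighted_integral_Pearson:
  assumes "\<alpha> > 0" "t > 0"
  shows "weighted_integral \<alpha> t ((1 - monom 2 2 + monom 1 4) * pderiv q) =
         weighted_integral \<alpha> t ((monom (2 * (\<alpha> + 2 + t)) 1 - monom (2 * (\<alpha> + 2)) 3) * q)"
proof -
  let ?r = "(1 - monom 2 2 + monom 1 4) * pderiv q -
            (monom (2 * (\<alpha> + 2 + t)) 1 - monom (2 * (\<alpha> + 2)) 3) * q"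
  let ?F = "\<lambda>x. (1 - x\<^sup>2)\<^sup>2 * poly q x * weight \<alpha> t x"
  have "((\<lambda>x. poly ?r x * weight \<alpha> t x) has_integral ?F 1 - ?F (-1)) {-1..1}"
  proof (rule fundamental_theorem_of_calculus_interior)
    show "continuous_on {-1..1} ?F"
      using weight_continuous[OF assms] by (auto intro!: continuous_intros)
    fix x :: real
    assume x: "x \<in> {-1<..<1}"
    then have pos: "1 - x\<^sup>2 \<noteq> 0"
      using abs_square_less_1[of x] by auto
    have "(?F has_real_derivative
            (1 - x\<^sup>2)\<^sup>2 * poly q x * (- (2 * x * (\<alpha> * (1 - x\<^sup>2) + t)) / (1 - x\<^sup>2)\<^sup>2 * weight \<alpha> t x) +
            ((1 - x\<^sup>2)\<^sup>2 * poly (pderiv q) x - 4 * x * (1 - x\<^sup>2) * poly q x) * weight \<alpha> t x) (at x)"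
      by (rule derivative_eq_intros weight_deriv[OF x] refl poly_DERIV | simp)+
    also have "(1 - x\<^sup>2)\<^sup>2 * poly q x * (- (2 * x * (\<alpha> * (1 - x\<^sup>2) + t)) / (1 - x\<^sup>2)\<^sup>2 * weight \<alpha> t x) =
               poly q x * (- (2 * x * (\<alpha> * (1 - x\<^sup>2) + t)) * weight \<alpha> t x)"
      using pos by simp
    finally have "(?F has_real_derivative
        poly q x * (- (2 * x * (\<alpha> * (1 - x\<^sup>2) + t)) * weight \<alpha> t x) +
        ((1 - x\<^sup>2)\<^sup>2 * poly (pderiv q) x - 4 * x * (1 - x\<^sup>2) * poly q x) * weight \<alpha> t x) (at x)" .
    also have "poly q x * (- (2 * x * (\<alpha> * (1 - x\<^sup>2) + t)) * weight \<alpha> t x) +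
        ((1 - x\<^sup>2)\<^sup>2 * poly (pderiv q) x - 4 * x * (1 - x\<^sup>2) * poly q x) * weight \<alpha> t x =
        poly ?r x * weight \<alpha> t x"
      by (simp add: poly_monom) algebra
    finally show "(?F has_vector_derivative poly ?r x * weight \<alpha> t x) (at x)"
      by (simp add: has_real_derivative_iff_has_vector_derivative)
  qed simp
  then have "weighted_integral \<alpha> t ?r = 0"
    by (simp add: weighted_integral_def integral_unique)
  moreover have "weighted_integral \<alpha> t (f - g) = weighted_integral \<alpha> t f - weighted_integral \<alpha> t g" for f g
    using integral_diff[OF weighted_integrable[OF assms, of f] weighted_integrable[OF assms, of g]]
    by (simp add: weighted_integral_def left_diff_distrib)
  ultimately show ?thesis
    by simp
qed

theorem theorem2p3:
  fixes \<alpha> t :: real and P :: "nat \<Rightarrow> real poly" and h :: "nat \<Rightarrow> real"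
    and p :: "nat \<Rightarrow> real" and n :: nat and pm pp :: real
  assumes "\<alpha> > 0" and "t > 0"
    and "monic_orthogonal_family \<alpha> t P h"
    and "p = subleading P"
    and "n \<ge> 1"
    and "pm = (2 * real n - 3 + 2 * \<alpha>) * (p (n - 1) - p n)"
    and "pp = (2 * real n + 1 + 2 * \<alpha>) * (p n - p (n + 1))"
  shows "(real n + 2 * p n - pp) ^ 3
       + (real n + 2 * p n - pp)\<^sup>2 * (real n - 2 + 4 * t - pm + pp)
       - 2 * (real n + 2 * p n - pp) *
           ((real n)\<^sup>2 - real n * (1 - \<alpha>) - \<alpha> + 2 * t - 2 * t\<^sup>2
             - pm * (real n + \<alpha> - t - pp)
             - (real n - 1 + 2 * t) * pp)
       - (real n - 1 + 2 * t - pm) *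
           (2 * real n * t - pp * (real n - 1 + 2 * t - pm))
       + 4 * (p n)\<^sup>2 * pp
       + 2 * p n *
           ((real n + 2 * p n - pp)\<^sup>2
             + 2 * pp * (real n - 1 + 2 * t - pm)
             - 2 * (real n + 2 * p n - pp) * (real n + \<alpha> - t - pp)
             - 2 * real n * t)
       = 0"
proof -
  \<comment> \<open>The shift turns the factors 2n - 3 and 2n + 1 into 2m - 1 and 2m + 3.\<close>
  obtain m where n: "n = Suc m"
    using \<open>n \<ge> 1\<close> by (cases n) auto
  note fam = assms(3)[unfolded monic_orthogonal_family_def]
  interpret semiclassical_polys "weighted_integral \<alpha> t" P \<alpha> t
  proof
    show "lead_coeff (P k) = 1" for k
      using fam by blast
    fix i j :: nat
    assume "i \<noteq> j"
    then show "weighted_integral \<alpha> t (P i * P j) = 0"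
      using conjunct2[OF fam, rule_format, of i j]
      by (simp add: weighted_integral_def integral_unique)
  qed (use fam assms(1,2) in \<open>auto simp: weighted_integral_add weighted_integral_smult
      weighted_integral_even weighted_integral_Pearson intro: weighted_integral_definite\<close>)
  have "pm = (2 * real m - 1 + 2 * \<alpha>) * \<beta> m"
    and "pp = (2 * real m + 3 + 2 * \<alpha>) * \<beta> (Suc m)"
    using assms(4,6,7) by (simp_all add: n \<beta>_def)
  from difference_equation[OF this refl refl refl] show ?thesis
    unfolding n assms(4) .
qed

end
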